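(* For all even integers $n \ge 4$, there exists a $3$-regular graph $G$ with $n$ vertices satisfying $$u(G) \ge \left\lfloor \frac{n}{24} \right\rfloor.$$
   Context: Graphs are finite and simple. The Toucher-Isolator game on a graph $G=(V(G),E(G))$: two players, Toucher and Isolator, alternately claim previously unclaimed edges of $G$, one edge per move, with Toucher making the first move, until all edges are claimed. A vertex is touched if it is incident to at least one edge claimed by Toucher, and untouched otherwise (i.e. all of its incident edges have been claimed by Isolator). Toucher aims to minimise, and Isolator to maximise, the number of untouched vertices at the end of the game. $u(G)$ denotes the number of untouched vertices at the end of the game when both players play optimally (the minimax value of this game). *)

theory Defs
  imports Complex_Main
begin

definition simple_graph :: "'a set \<Rightarrow> 'a set set \<Rightarrow> bool" where
  "simple_graph V E \<longleftrightarrow> finite V \<and> (\<forall>e\<in>E. e \<subseteq> V \<and> card e = 2)"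

definition degree :: "'a set set \<Rightarrow> 'a \<Rightarrow> nat" where
  "degree E v = card {e \<in> E. v \<in> e}"

definition regular_graph :: "nat \<Rightarrow> 'a set \<Rightarrow> 'a set set \<Rightarrow> bool" where
  "regular_graph d V E \<longleftrightarrow> simple_graph V E \<and> (\<forall>v\<in>V. degree E v = d)"

datatype player = Toucher | Isolator

definition untouched :: "'a set \<Rightarrow> 'a set set \<Rightarrow> 'a set" where
  "untouched V T = {v \<in> V. \<not> (\<exists>e\<in>T. v \<in> e)}"

text \<open>
  \<open>minimax V E p T I\<close> is the number of untouched vertices at the end of the game under optimal
  play, starting from the position in which Toucher has claimed the edges in \<open>T\<close>, Isolator
  those in \<open>I\<close>, and it is player \<open>p\<close>'s turn. The finiteness guard is only there to make
  the recursion terminate; it always holds for the edge set of a finite graph.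
\<close>

function minimax ::
  "'a set \<Rightarrow> 'a set set \<Rightarrow> player \<Rightarrow> 'a set set \<Rightarrow> 'a set set \<Rightarrow> nat" where
  "minimax V E p T I =
    (if infinite E \<or> E - (T \<union> I) = {} then card (untouched V T)
     else case p of
       Toucher \<Rightarrow> Min ((\<lambda>e. minimax V E Isolator (insert e T) I) ` (E - (T \<union> I)))
     | Isolator \<Rightarrow> Max ((\<lambda>e. minimax V E Toucher T (insert e I)) ` (E - (T \<union> I))))"
  by pat_completeness auto

termination
  by (relation "measure (\<lambda>(V, E, p, T, I). card (E - (T \<union> I)))")
     (simp, (simp only: in_measure case_prod_conv, rule psubset_card_mono; blast)+)

declare minimax.simps [simp del]

definition u :: "'a set \<Rightarrow> 'a set set \<Rightarrow> nat" where
  "u V E = minimax V E Toucher {} {}"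

end

theory Submission
  imports Defs
begin

text \<open>
  The graph is a disjoint union of \<open>2k\<close> Moebius ladders on ten vertices, where
  \<open>k = n div 24\<close>, and one more Moebius ladder on the other \<open>n - 20k\<close> vertices. The
  latter exists because \<open>n - 20k\<close> is even and at least \<open>4\<close>: for \<open>k = 0\<close> it is \<open>n\<close>, and
  otherwise it is at least \<open>4k\<close>.

  The heart of the matter is that Isolator, moving first on a ten-vertex ladder, can isolate a vertex
  of it (\<open>ladder5_isolator_first\<close>). In a cubic graph, an untouched vertex with two edges of Isolator is
  a threat: Toucher has to take the third edge at once. Hence a path of untouched
  vertices without chords whose two ends already carry an edge of Isolator is deadly: Isolator claims
  its edges one after the other, each claim creating a threat at the vertex left behind, Toucher's
  forced answers lead away from the path, and the last edge creates two threats at once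
  (\<open>open_path_wins\<close>). Isolator's opening is a rung. Whatever Toucher answers, a second edge can be
  chosen such that no single edge of Toucher meets all the open paths that Isolator then has.

  Globally, Isolator opens one small ladder after the other. A ladder that has been opened is defended by
  answering inside it. If Toucher plays in a ladder not yet opened, that ladder is given up,
  and Isolator opens another one. So one ladder is gained for every ladder lost, and half of the \<open>2k\<close>
  ladders end up with an untouched vertex (\<open>half_the_boards_le_u\<close>). Moves elsewhere do no harm, because
  an additional edge never hurts Isolator.
\<close>

section \<open>Isolating a vertex of one board\<close>

text \<open>
  Toucher is to move on the board \<open>B\<close>, and Isolator has a strategy that only plays inside \<open>B\<close> and
  ends with a vertex of \<open>B\<close> all of whose edges are Isolator's (this reading supposes that neither \<open>B\<close>
  nor an edge in it is empty). Both players may pass by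
  repeating one of their own edges: \<open>e\<close> may lie in \<open>T\<close> and \<open>f\<close> in \<open>I\<close>. This is sound, since a
  superfluous move of Isolator is harmless, and it makes the notion monotone and free of side
  conditions about boards that are already full.
\<close>

inductive wins :: "'a set set \<Rightarrow> 'a set set \<Rightarrow> 'a set set \<Rightarrow> bool" for B where
  isolated: "v \<in> \<Union>B \<Longrightarrow> (\<And>e. e \<in> B \<Longrightarrow> v \<in> e \<Longrightarrow> e \<in> I) \<Longrightarrow> wins B T I"
| reply: "(\<And>e. e \<in> B - I \<Longrightarrow> \<exists>f\<in>B - insert e T. wins B (insert e T) (insert f I)) \<Longrightarrow> wins B T I"

text \<open>
  Only the part of the position inside \<open>B\<close> matters, and fewer edges of Toucher and more edges
  of Isolator only help Isolator.
\<close>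

lemma wins_mono:
  assumes "wins B T I" "T' \<inter> B \<subseteq> T" "I \<inter> B \<subseteq> I'"
  shows "wins B T' I'"
  using assms
proof (induction arbitrary: T' I' rule: wins.induct)
  case (isolated v I T)
  then show ?case by (intro wins.isolated[of v]) auto
next
  case (reply I T)
  show ?case
  proof (rule wins.reply)
    fix e assume e: "e \<in> B - I'"
    then have "e \<in> B - I" using reply.prems by auto
    from reply.IH[OF this] obtain f where f: "f \<in> B - insert e T"
      and IH: "\<And>T' I'. T' \<inter> B \<subseteq> insert e T \<Longrightarrow> insert f I \<inter> B \<subseteq> I' \<Longrightarrow> wins B T' I'"
      by metis
    have "wins B (insert e T') (insert f I')"
      by (rule IH) (use reply.prems in auto)
    moreover have "f \<in> B - insert e T'" using f reply.prems by auto
    ultimately show "\<exists>f\<in>B - insert e T'. wins B (insert e T') (insert f I')" by blast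
  qed
qed

lemma wins_image:
  assumes "wins B T I" "inj \<phi>"
  shows "wins ((`) \<phi> ` B) ((`) \<phi> ` T) ((`) \<phi> ` I)"
  using assms(1)
proof (induction rule: wins.induct)
  case (isolated v I T)
  show ?case
  proof (rule wins.isolated[of "\<phi> v"])
    show "\<phi> v \<in> \<Union>((`) \<phi> ` B)" using isolated by auto
  next
    fix e assume "e \<in> (`) \<phi> ` B" "\<phi> v \<in> e"
    then obtain d where "d \<in> B" "e = \<phi> ` d" "v \<in> d"
      using assms(2) by (auto simp: inj_eq)
    then show "e \<in> (`) \<phi> ` I" using isolated by blast
  qed
next
  case (reply I T)
  show ?case
  proof (rule wins.reply)
    fix e' assume "e' \<in> (`) \<phi> ` B - (`) \<phi> ` I"
    then obtain e where e: "e' = \<phi> ` e" "e \<in> B - I" by auto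
    from reply.IH[OF e(2)] obtain f where f: "f \<in> B - insert e T"
      and w: "wins ((`) \<phi> ` B) ((`) \<phi> ` insert e T) ((`) \<phi> ` insert f I)" by blast
    have "\<phi> ` f \<in> (`) \<phi> ` B - insert e' ((`) \<phi> ` T)"
      using f e(1) inj_image_eq_iff[OF assms(2)] by auto
    then show "\<exists>f\<in>(`) \<phi> ` B - insert e' ((`) \<phi> ` T).
        wins ((`) \<phi> ` B) (insert e' ((`) \<phi> ` T)) (insert f ((`) \<phi> ` I))"
      using w unfolding e(1) image_insert by (rule bexI[rotated])
  qed
qed

text \<open>
  When every edge of the board has been claimed, all that is left to both players is to pass, so the
  strategy has already reached its goal.
\<close>

lemma wins_at_end:
  assumes "wins B T I" "B \<subseteq> T \<union> I" "T \<inter> I = {}" and B: "B \<noteq> {}" "{} \<notin> B"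
  shows "\<exists>v\<in>\<Union>B. \<forall>e\<in>B. v \<in> e \<longrightarrow> e \<in> I"
  using assms(1-3)
proof (induction rule: wins.induct)
  case (isolated v I T)
  then show ?case by blast
next
  case (reply I T)
  show ?case
  proof (cases "B \<subseteq> I")
    case True
    obtain e where e: "e \<in> B" using B(1) by blast
    then have "e \<noteq> {}" using B(2) by blast
    then obtain v where "v \<in> e" by blast
    then show ?thesis using True e by blast
  next
    case False
    then obtain e where e: "e \<in> B - I" by blast
    then obtain f where f: "f \<in> B - insert e T"
      and IH: "B \<subseteq> insert e T \<union> insert f I \<longrightarrow> insert e T \<inter> insert f I = {} \<longrightarrow>
        (\<exists>v\<in>\<Union>B. \<forall>e\<in>B. v \<in> e \<longrightarrow> e \<in> insert f I)"
      using reply.IH[OF e] by metis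
    have "insert e T = T" "insert f I = I"
      using e f reply.prems(1) by auto
    then show ?thesis using IH reply.prems by simp
  qed
qed

text \<open>
  A threat that Toucher failed to parry: Isolator takes the missing edge, or any edge at \<open>p\<close> if none
  is missing.
\<close>

lemma wins_if_one_edge_missing:
  assumes "p \<in> \<Union>B" "\<forall>t\<in>T. p \<notin> t" "finite B" "card ({e \<in> B. p \<in> e} - I) \<le> 1"
  shows "\<exists>f\<in>B - T. wins B T (insert f I)"
proof -
  obtain g where g: "g \<in> B" "p \<in> g" using assms(1) by blast
  have "\<exists>f. f \<in> {e \<in> B. p \<in> e} \<and> {e \<in> B. p \<in> e} - I \<subseteq> {f}"
  proof (cases "{e \<in> B. p \<in> e} - I = {}")
    case True
    then show ?thesis using g by blast
  next
    case False
    then have "card ({e \<in> B. p \<in> e} - I) = 1"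
      using assms(3,4) by (simp add: card_gt_0_iff order_antisym Suc_le_eq)
    then obtain f where "{e \<in> B. p \<in> e} - I = {f}" by (auto simp: card_1_singleton_iff)
    then show ?thesis by blast
  qed
  then obtain f where f: "f \<in> B" "p \<in> f" "{e \<in> B. p \<in> e} - I \<subseteq> {f}" by blast
  have "wins B T (insert f I)" by (rule wins.isolated[of p]) (use f assms(1) in auto)
  moreover have "f \<notin> T" using f(2) assms(2) by blast
  ultimately show ?thesis using f(1) by blast
qed

lemma card_star_minus_le_1:
  assumes "finite B" "degree B p \<le> 3" "g \<in> B" "h \<in> B" "p \<in> g" "p \<in> h" "g \<noteq> h" "g \<in> I" "h \<in> I"
  shows "card ({e \<in> B. p \<in> e} - I) \<le> 1"
proof -
  have "card ({e \<in> B. p \<in> e} - I) \<le> card ({e \<in> B. p \<in> e} - {g, h})"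
    by (rule card_mono) (use assms in auto)
  also have "\<dots> = degree B p - 2"
    unfolding degree_def using assms by (subst card_Diff_subset) auto
  finally show ?thesis using assms(2) by linarith
qed

text \<open>
  The vertices of the list are untouched and pairwise distinct, consecutive ones are joined by unclaimed
  edges, the last one already carries an edge of Isolator, and every chord belongs to Isolator.
  Allowing these chords means that a cycle with a single edge of Isolator gives an
  open path, namely the cycle without that edge. That the first vertex carries an edge of Isolator as
  well is a separate hypothesis of \<open>open_path_wins\<close>.
\<close>

fun open_path :: "'a set set \<Rightarrow> 'a set set \<Rightarrow> 'a set set \<Rightarrow> 'a list \<Rightarrow> bool" where
  "open_path B T I [] = False"
| "open_path B T I [p] = ((\<forall>t\<in>T. p \<notin> t) \<and> (\<exists>g\<in>I \<inter> B. p \<in> g))"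
| "open_path B T I (p # q # ps) =
    ((\<forall>t\<in>T. p \<notin> t) \<and> p \<notin> set (q # ps) \<and> {p, q} \<in> B - I
      \<and> (\<forall>r\<in>set ps. {p, r} \<notin> B - I) \<and> open_path B T I (q # ps))"

lemma open_path_advance:
  assumes "open_path B T I ps" "e \<inter> set ps = {}" "p \<notin> set ps"
  shows "open_path B (insert e T) (insert {p, q} I) ps"
  using assms by (induction B T I ps rule: open_path.induct) (auto simp: doubleton_eq_iff)

text \<open>
  Isolator claims the first edge \<open>{p, q}\<close> of the path. Now \<open>p\<close> lacks only one edge, so Toucher
  must take it; the other end of that edge is off the path because there are no unclaimed chords. So the
  path from \<open>q\<close> on is open again, with \<open>{p, q}\<close> as the edge of Isolator at its first vertex. When
  \<open>{p, q}\<close> is the last edge, both \<open>p\<close> and \<open>q\<close> become threats, and these lack different edges.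
\<close>

lemma open_path_wins:
  assumes board: "finite B" "\<forall>e\<in>B. card e = 2" "\<forall>v. degree B v \<le> 3"
    and "open_path B T I (p # q # ps)" "g \<in> I \<inter> B" "p \<in> g"
  shows "\<exists>f\<in>B - T. wins B T (insert f I)"
  using assms(4-)
proof (induction ps arbitrary: T I p q g)
  case Nil
  let ?I = "insert {p, q} I"
  have pq: "{p, q} \<in> B" "{p, q} \<notin> I" "p \<noteq> q" and p: "\<forall>t\<in>T. p \<notin> t" and q: "\<forall>t\<in>T. q \<notin> t"
    using Nil by auto
  obtain h where h: "h \<in> I" "h \<in> B" "q \<in> h" using Nil by auto
  have "wins B T ?I"
  proof (rule wins.reply)
    fix e assume e: "e \<in> B - ?I"
    \<comment> \<open>The only edge through both \<open>p\<close> and \<open>q\<close> is the one that Isolator has just claimed.\<close>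
    have "p \<notin> e \<or> q \<notin> e"
      using e board(2) pq(3) by (auto simp: card_2_iff)
    then show "\<exists>f\<in>B - insert e T. wins B (insert e T) (insert f ?I)"
    proof
      assume "p \<notin> e"
      moreover have "card ({e \<in> B. p \<in> e} - ?I) \<le> 1"
        by (rule card_star_minus_le_1[of B p g "{p, q}"]) (use board pq Nil.prems in auto)
      ultimately show ?thesis
        by (intro wins_if_one_edge_missing[of p]) (use p pq board in auto)
    next
      assume "q \<notin> e"
      moreover have "card ({e \<in> B. q \<in> e} - ?I) \<le> 1"
        by (rule card_star_minus_le_1[of B q h "{p, q}"]) (use board pq h in auto)
      ultimately show ?thesis
        by (intro wins_if_one_edge_missing[of q]) (use q pq board in auto)
    qed
  qed
  moreover have "{p, q} \<in> B - T" using pq p by auto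
  ultimately show ?case by blast
next
  case (Cons r ps)
  let ?I = "insert {p, q} I"
  have pq: "{p, q} \<in> B" "{p, q} \<notin> I" and p: "\<forall>t\<in>T. p \<notin> t" "p \<notin> set (q # r # ps)"
    and chord: "\<forall>s\<in>set (r # ps). {p, s} \<notin> B - I" and tail: "open_path B T I (q # r # ps)"
    using Cons.prems by (auto simp del: list.set)
  have "wins B T ?I"
  proof (rule wins.reply)
    fix e assume e: "e \<in> B - ?I"
    show "\<exists>f\<in>B - insert e T. wins B (insert e T) (insert f ?I)"
    proof (cases "p \<in> e")
      case False
      moreover have "card ({e \<in> B. p \<in> e} - ?I) \<le> 1"
        by (rule card_star_minus_le_1[of B p g "{p, q}"]) (use board pq Cons.prems in auto)
      ultimately show ?thesis
        by (intro wins_if_one_edge_missing[of p]) (use p pq board in auto)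
    next
      case True
      then obtain s where s: "e = {p, s}"
        using e board(2) by (fastforce simp: card_2_iff)
      have "s \<notin> set (q # r # ps)" using s e chord by auto
      then have "e \<inter> set (q # r # ps) = {}" using s p(2) by auto
      then have "open_path B (insert e T) ?I (q # r # ps)"
        by (intro open_path_advance tail p(2))
      then show ?thesis
        by (rule Cons.IH[where g = "{p, q}"]) (use pq in auto)
    qed
  qed
  moreover have "{p, q} \<in> B - T" using pq p by auto
  ultimately show ?case by blast
qed

section \<open>Moebius ladders\<close>

text \<open>
  The cycle \<open>0, 1, \<dots>, 2h - 1\<close> together with the rungs that join opposite vertices. For \<open>h = 2\<close> this
  is the complete graph on four vertices.
\<close>

definition ladder :: "nat \<Rightarrow> nat set set" where
  "ladder h = {{i, i + 1} | i. i + 1 < 2 * h} \<union> {{0, 2 * h - 1}} \<union> {{i, i + h} | i. i < h}"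

lemma star_ladder:
  assumes "h \<ge> 2" "v < 2 * h"
  shows "{e \<in> ladder h. v \<in> e} = (\<lambda>w. {v, w}) `
    {if v + 1 = 2 * h then 0 else v + 1, if v = 0 then 2 * h - 1 else v - 1,
     if v < h then v + h else v - h}" (is "?L = ?R")
proof
  show "?L \<subseteq> ?R"
  proof
    fix e assume "e \<in> ?L"
    then have v: "v \<in> e" and "e \<in> ladder h" by simp_all
    then consider (rim) i where "e = {i, i + 1}" "i + 1 < 2 * h"
      | (closing) "e = {0, 2 * h - 1}" | (rung) i where "e = {i, i + h}" "i < h"
      unfolding ladder_def by blast
    then show "e \<in> ?R"
    proof cases
      case rim
      then have "v = i \<or> v = i + 1" using v by simp
      then show ?thesis using rim by (elim disjE) (simp_all add: insert_commute)
    next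
      case closing
      then have "v = 0 \<or> v = 2 * h - 1" using v by simp
      then show ?thesis using closing assms by (elim disjE) (simp_all add: insert_commute)
    next
      case rung
      then have "v = i \<or> v = i + h" using v by simp
      then show ?thesis using rung by (elim disjE) (simp_all add: insert_commute)
    qed
  qed
  have rim: "{i, i + 1} \<in> ladder h" if "i + 1 < 2 * h" for i
    unfolding ladder_def using that by blast
  have rung: "{i, i + h} \<in> ladder h" if "i < h" for i
    unfolding ladder_def using that by blast
  have closing: "{0, 2 * h - 1} \<in> ladder h"
    unfolding ladder_def by blast
  have "{v, if v + 1 = 2 * h then 0 else v + 1} \<in> ladder h"
  proof (cases "v + 1 = 2 * h")
    case True
    then have "v = 2 * h - 1" by simp
    then show ?thesis using closing assms by (simp add: insert_commute)
  qed (use rim[of v] assms in simp)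
  moreover have "{v, if v = 0 then 2 * h - 1 else v - 1} \<in> ladder h"
    using rim[of "v - 1"] closing assms by (cases "v = 0") (simp_all add: insert_commute)
  moreover have "{v, if v < h then v + h else v - h} \<in> ladder h"
    using rung[of v] rung[of "v - h"] assms by (cases "v < h") (simp_all add: insert_commute)
  ultimately show "?R \<subseteq> ?L" by blast
qed

lemma regular_ladder:
  assumes "h \<ge> 2"
  shows "regular_graph 3 {..<2 * h} (ladder h)"
proof -
  have "card e = 2 \<and> e \<subseteq> {..<2 * h}" if "e \<in> ladder h" for e
    using that assms unfolding ladder_def by (auto simp: card_insert_if)
  moreover have "degree (ladder h) v = 3" if "v < 2 * h" for v
  proof -
    define a where "a = (if v + 1 = 2 * h then 0 else v + 1)"
    define b where "b = (if v = 0 then 2 * h - 1 else v - 1)"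
    define c where "c = (if v < h then v + h else v - h)"
    have "a \<noteq> b" "a \<noteq> c" "b \<noteq> c"
      using assms that unfolding a_def b_def c_def by (simp_all split: if_split) linarith+
    then have "card {a, b, c} = 3" by simp
    moreover have "inj_on (\<lambda>w. {v, w}) {a, b, c}"
      by (auto simp: inj_on_def doubleton_eq_iff)
    ultimately show ?thesis
      unfolding degree_def star_ladder[OF assms that] a_def b_def c_def by (metis card_image)
  qed
  ultimately show ?thesis unfolding regular_graph_def simple_graph_def by auto
qed

lemma ladder5:
  "ladder 5 = {{0,1},{1,2},{2,3},{3,4},{4,5},{5,6},{6,7},{7,8},{8,9},{0,9},
               {0,5},{1,6},{2,7},{3,8},{4,9}}"
proof -
  have "{..<9} = {0, 1, 2, 3, 4, 5, 6, 7, 8::nat}" "{..<5} = {0, 1, 2, 3, 4::nat}" by auto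
  moreover have "{{i, i + 1} | i. i + 1 < 2 * (5::nat)} = (\<lambda>i. {i, i + 1}) ` {..<9}" by auto
  moreover have "{{i, i + 5} | i. i < (5::nat)} = (\<lambda>i. {i, i + 5}) ` {..<5}" by auto
  ultimately show ?thesis
    unfolding ladder_def by (simp del: One_nat_def add: insert_commute)
qed

lemma edge_ladder5:
  "{x, y} \<in> ladder 5 \<longleftrightarrow> x < 10 \<and> y < 10 \<and>
    (y = x + 1 \<or> x = y + 1 \<or> y = x + 5 \<or> x = y + 5 \<or> x = 0 \<and> y = 9 \<or> x = 9 \<and> y = 0)"
  unfolding ladder_def by (auto simp: doubleton_eq_iff)

text \<open>
  Isolator opens with the rung \<open>{0, 5}\<close>. Let \<open>a\<close> be Toucher's answer. If \<open>a\<close> touches neither \<open>0\<close> nor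
  \<open>5\<close>, then it also leaves alone one of the two adjacent rungs \<open>{1, 6}\<close> and \<open>{9, 4}\<close>. Isolator
  claims that rung and owns two opposite edges of a 4-cycle of untouched vertices; each of the other two
  edges is an open path, and Toucher cannot meet both with one edge. If \<open>a\<close> touches \<open>0\<close> or \<open>5\<close>, say
  \<open>a = {0, 1}\<close>, then Isolator claims the rung \<open>{2, 7}\<close>. It lies on a 4-cycle of untouched vertices and
  is linked to \<open>5\<close> by two further open paths, and again no unclaimed edge meets all three. The other
  three answers of this kind are images of \<open>{0, 1}\<close> under symmetries that preserve the rung
  \<open>{0, 5}\<close>.
\<close>

lemma ladder5_isolator_first:
  "\<exists>f\<in>ladder 5. wins (ladder 5) {} {f}"
proof
  let ?B = "ladder 5 :: nat set set"
  have reg: "regular_graph 3 {..<10} ?B" using regular_ladder[of 5] by simp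
  have fin: "finite ?B" unfolding ladder5 by simp
  have two: "\<forall>e\<in>?B. card e = 2" using reg by (simp add: regular_graph_def simple_graph_def)
  have deg: "\<forall>v. degree ?B v \<le> 3"
  proof
    fix v
    show "degree ?B v \<le> 3"
    proof (cases "v < 10")
      case False
      then have "{e \<in> ?B. v \<in> e} = {}"
        using reg by (fastforce simp: regular_graph_def simple_graph_def)
      then show ?thesis unfolding degree_def by (metis card.empty le0)
    qed (use reg in \<open>simp add: regular_graph_def\<close>)
  qed
  note path = open_path_wins[OF fin two deg]
  show "{0, 5} \<in> ?B" unfolding ladder5 by (simp add: doubleton_eq_iff)
  have "wins ?B {} {{0, 5}}"
  proof (rule wins.reply)
    fix a assume a: "a \<in> ?B - {{0, 5}}"
    \<comment> \<open>The second edge \<open>f\<close> is good if every further edge \<open>b\<close> of Toucher leaves some open path.\<close>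
    have answer: "\<exists>f\<in>?B - {a}. wins ?B {a} {f, {0, 5}}"
      if f: "f \<in> ?B" "f \<noteq> a" and respond:
        "\<And>b. b \<in> ?B \<Longrightarrow> b \<noteq> f \<Longrightarrow> b \<noteq> {0, 5} \<Longrightarrow>
          \<exists>g\<in>{f, {0, 5}}. \<exists>p\<in>g. \<exists>q ps.
            open_path ?B {b, a} {f, {0, 5}} (p # q # ps)" for f
    proof -
      have "wins ?B {a} {f, {0, 5}}"
      proof (rule wins.reply)
        fix b assume "b \<in> ?B - {f, {0, 5}}"
        then have "b \<in> ?B" "b \<noteq> f" "b \<noteq> {0, 5}" by simp_all
        from respond[OF this] obtain g p q ps where g: "g \<in> {f, {0, 5}}" "p \<in> g"
          and ps: "open_path ?B {b, a} {f, {0, 5}} (p # q # ps)" by (elim bexE exE)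
        have "{f, {0, 5}} \<subseteq> ?B" using f(1) \<open>{0, 5} \<in> ?B\<close> by simp
        then have "g \<in> {f, {0, 5}} \<inter> ?B" using g(1) by blast
        from path[OF ps this g(2)]
        show "\<exists>h\<in>?B - {b, a}. wins ?B {b, a} (insert h {f, {0, 5}})" .
      qed
      then show ?thesis using f by blast
    qed
    have square: "\<exists>f\<in>?B - {a}. wins ?B {a} {f, {0, 5}}"
      if "0 \<notin> a" "5 \<notin> a" "p \<notin> a" "q \<notin> a" and pq: "p = 1 \<and> q = 6 \<or> p = 9 \<and> q = 4" for p q
    proof (rule answer[of "{p, q}"])
      show "{p, q} \<in> ?B" using pq by (auto simp: edge_ladder5)
      show "{p, q} \<noteq> a" using \<open>p \<notin> a\<close> by blast
      fix b assume "b \<in> ?B" "b \<noteq> {p, q}" "b \<noteq> {0, 5}"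
      then have "0 \<notin> b \<and> p \<notin> b \<or> 5 \<notin> b \<and> q \<notin> b"
        using pq unfolding ladder5
        by (elim disjE conjE insertE emptyE) (simp_all add: doubleton_eq_iff)
      then show "\<exists>g\<in>{{p, q}, {0, 5}}. \<exists>p'\<in>g. \<exists>q' ps.
          open_path ?B {b, a} {{p, q}, {0, 5}} (p' # q' # ps)"
      proof
        assume "0 \<notin> b \<and> p \<notin> b"
        then have "open_path ?B {b, a} {{p, q}, {0, 5}} [0, p]"
          using that by (elim disjE) (simp_all add: edge_ladder5 doubleton_eq_iff)
        then show ?thesis by (meson insertI1 insertI2)
      next
        assume "5 \<notin> b \<and> q \<notin> b"
        then have "open_path ?B {b, a} {{p, q}, {0, 5}} [5, q]"
          using that by (elim disjE) (simp_all add: edge_ladder5 doubleton_eq_iff)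
        then show ?thesis by (meson insertI1 insertI2)
      qed
    qed
    \<comment> \<open>Each entry: the answer \<open>a\<close>, the second edge, and three open paths with no common obstruction.
        The rows arise from the first one by the identity, \<open>x \<mapsto> -x\<close>, \<open>x \<mapsto> 5 - x\<close> and
        \<open>x \<mapsto> 5 + x\<close> modulo \<open>10\<close>.\<close>
    define detours :: "(nat set \<times> nat set \<times> nat list \<times> nat list \<times> nat list) set" where
      "detours = {({0, 1}, {2, 7}, [5, 6, 7], [2, 3, 8, 7], [2, 3, 4, 5]),
                  ({0, 9}, {8, 3}, [5, 4, 3], [8, 7, 2, 3], [8, 7, 6, 5]),
                  ({5, 4}, {3, 8}, [0, 9, 8], [3, 2, 7, 8], [3, 2, 1, 0]),
                  ({5, 6}, {7, 2}, [0, 1, 2], [7, 8, 3, 2], [7, 8, 9, 0])}"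
    have detour: "\<exists>f\<in>?B - {a}. wins ?B {a} {f, {0, 5}}"
      if tab: "(a, f, P, Q, R) \<in> detours" for f P Q R
    proof (rule answer[of f])
      show "f \<in> ?B" "f \<noteq> a"
        using tab unfolding detours_def
        by (elim insertE emptyE; simp add: edge_ladder5 doubleton_eq_iff)+
      fix b assume b: "b \<in> ?B" "b \<noteq> f" "b \<noteq> {0, 5}"
      have "b \<inter> set P = {} \<or> b \<inter> set Q = {} \<or> b \<inter> set R = {}"
        using tab b unfolding detours_def ladder5
        by (elim insertE emptyE) (simp_all add: doubleton_eq_iff)
      then obtain ps where ps: "ps \<in> {P, Q, R}" "b \<inter> set ps = {}" by blast
      have "open_path ?B {b, a} {f, {0, 5}} ps"
        using tab ps unfolding detours_def
        by (elim insertE emptyE) (simp_all add: edge_ladder5 doubleton_eq_iff)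
      moreover have "\<exists>g\<in>{f, {0, 5}}. \<exists>p\<in>g. \<exists>q ps'. ps = p # q # ps'"
        using tab ps(1) unfolding detours_def by (elim insertE emptyE) simp_all
      ultimately show "\<exists>g\<in>{f, {0, 5}}. \<exists>p\<in>g. \<exists>q ps.
            open_path ?B {b, a} {f, {0, 5}} (p # q # ps)" by metis
    qed
    consider (right) "0 \<notin> a" "5 \<notin> a" "1 \<notin> a" "6 \<notin> a"
      | (left) "0 \<notin> a" "5 \<notin> a" "9 \<notin> a" "4 \<notin> a"
      | (touching) "a \<in> fst ` detours"
    proof -
      have "0 \<notin> a \<and> 5 \<notin> a \<and> 1 \<notin> a \<and> 6 \<notin> a \<or> 0 \<notin> a \<and> 5 \<notin> a \<and> 9 \<notin> a \<and> 4 \<notin> a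
        \<or> a \<in> fst ` detours"
        using a unfolding ladder5 detours_def Diff_iff
        by (elim conjE insertE emptyE) (simp_all add: doubleton_eq_iff)
      then show ?thesis using that by argo
    qed
    then have "\<exists>f\<in>?B - {a}. wins ?B {a} {f, {0, 5}}"
    proof cases
      case right
      then show ?thesis by (intro square[of 1 6]) simp_all
    next
      case left
      then show ?thesis by (intro square[of 9 4]) simp_all
    next
      case touching
      then obtain f P Q R where "(a, f, P, Q, R) \<in> detours" by force
      then show ?thesis by (rule detour)
    qed
    then show "\<exists>f\<in>?B - insert a {}. wins ?B (insert a {}) (insert f {{0, 5}})" by simp
  qed
  then show "wins ?B {} {{0, 5}}" .
qed

section \<open>Playing on many components at once\<close>

lemma minimax_end:
  assumes "E - (T \<union> I) = {}"
  shows "minimax V E p T I = card (untouched V T)"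
  using assms by (subst minimax.simps) simp

lemma minimax_Toucher_ge:
  assumes "finite E" "E - (T \<union> I) \<noteq> {}"
    and "\<And>e. e \<in> E - (T \<union> I) \<Longrightarrow> k \<le> minimax V E Isolator (insert e T) I"
  shows "k \<le> minimax V E Toucher T I"
  using assms by (subst minimax.simps) (auto intro!: Min.boundedI)

lemma minimax_Isolator_ge:
  assumes "finite E" "g \<in> E - (T \<union> I)" "k \<le> minimax V E Toucher T (insert g I)"
  shows "k \<le> minimax V E Isolator T I"
proof -
  have "minimax V E Toucher T (insert g I)
      \<le> Max ((\<lambda>e. minimax V E Toucher T (insert e I)) ` (E - (T \<union> I)))"
    by (rule Max_ge) (use assms in auto)
  moreover have "minimax V E Isolator T I
      = Max ((\<lambda>e. minimax V E Toucher T (insert e I)) ` (E - (T \<union> I)))"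
    using assms(1,2) by (subst minimax.simps) auto
  ultimately show ?thesis using assms(3) by linarith
qed

text \<open>
  The boards are connected components, or unions of components, of \<open>(V, E)\<close>, on each of which
  Isolator wins when moving first; the rest of the graph is arbitrary.
\<close>

locale boards =
  fixes V :: "'a set" and E :: "'a set set" and \<B> :: "'a set set set"
  assumes finite_V: "finite V" and finite_E: "finite E"
    and empty_notin_E: "{} \<notin> E"
    and board: "B \<in> \<B> \<Longrightarrow> B \<subseteq> E \<and> B \<noteq> {} \<and> \<Union>B \<subseteq> V"
    and closed: "B \<in> \<B> \<Longrightarrow> e \<in> E \<Longrightarrow> v \<in> e \<Longrightarrow> v \<in> \<Union>B \<Longrightarrow> e \<in> B"
    and disjoint: "B \<in> \<B> \<Longrightarrow> C \<in> \<B> \<Longrightarrow> B \<noteq> C \<Longrightarrow> \<Union>B \<inter> \<Union>C = {}"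
    and isolator_first: "B \<in> \<B> \<Longrightarrow> \<exists>f\<in>B. wins B {} {f}"
begin

text \<open>
  Toucher is to move, the boards in \<open>\<A>\<close> have been opened and are defended, and Toucher has not yet
  played in those of \<open>\<F>\<close>. Of the latter Isolator can secure one out of every two.
\<close>

definition promises :: "nat \<Rightarrow> 'a set set \<Rightarrow> 'a set set \<Rightarrow> bool" where
  "promises k T I \<longleftrightarrow> (\<exists>\<A> \<F>. \<A> \<subseteq> \<B> \<and> \<F> \<subseteq> \<B> \<and> \<A> \<inter> \<F> = {} \<and>
     (\<forall>B\<in>\<A>. wins B T I) \<and> (\<forall>B\<in>\<F>. T \<inter> B = {}) \<and> k \<le> card \<A> + card \<F> div 2)"

lemma promisesI:
  assumes "\<A> \<subseteq> \<B>" "\<F> \<subseteq> \<B>" "\<A> \<inter> \<F> = {}" "\<And>B. B \<in> \<A> \<Longrightarrow> wins B T I"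
    "\<And>B. B \<in> \<F> \<Longrightarrow> T \<inter> B = {}" "k \<le> card \<A> + card \<F> div 2"
  shows "promises k T I"
  unfolding promises_def by (intro exI[of _ \<A>] exI[of _ \<F>] conjI ballI assms)

lemma promisesE:
  assumes "promises k T I"
  obtains \<A> \<F> where "\<A> \<subseteq> \<B>" "\<F> \<subseteq> \<B>" "\<A> \<inter> \<F> = {}" "\<And>B. B \<in> \<A> \<Longrightarrow> wins B T I"
    "\<And>B. B \<in> \<F> \<Longrightarrow> T \<inter> B = {}" "k \<le> card \<A> + card \<F> div 2"
  using assms unfolding promises_def by (elim exE conjE) (rule that; simp)

lemma finite_boards: "finite \<B>"
  by (rule finite_subset[of _ "Pow E"]) (use board finite_E in auto)

lemma board_unique:
  assumes "B \<in> \<B>" "C \<in> \<B>" "e \<in> B" "e \<in> C"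
  shows "B = C"
proof (rule ccontr)
  assume "B \<noteq> C"
  then have "\<Union>B \<inter> \<Union>C = {}" using disjoint assms by blast
  moreover have "e \<noteq> {}" using assms board empty_notin_E by blast
  ultimately show False using assms by blast
qed

lemma wins_elsewhere:
  assumes "wins C T I" "C \<in> \<B>" "e \<notin> C" "I \<subseteq> I'"
  shows "wins C (insert e T) I'"
  by (rule wins_mono[OF assms(1)]) (use assms in auto)

lemma promises_mono:
  assumes "promises k T I" "I \<subseteq> I'"
  shows "promises k T I'"
proof -
  have mono: "wins B T I'" if "wins B T I" for B
    by (rule wins_mono[OF that]) (use assms(2) in auto)
  obtain \<A> \<F> where "\<A> \<subseteq> \<B>" "\<F> \<subseteq> \<B>" "\<A> \<inter> \<F> = {}" "\<And>B. B \<in> \<A> \<Longrightarrow> wins B T I"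
    "\<And>B. B \<in> \<F> \<Longrightarrow> T \<inter> B = {}" "k \<le> card \<A> + card \<F> div 2"
    using assms(1) by (rule promisesE) (rule that)
  then show ?thesis by (intro promisesI[of \<A> \<F>] mono)
qed

text \<open>
  Isolator answers in the board in which Toucher has just played if it is an opened one, and opens a
  fresh board if Toucher has spoilt another fresh one. The first alternative of the conclusion says that
  no particular answer is called for.
\<close>

lemma promises_step:
  assumes "promises k T I" "e \<in> E - (T \<union> I)"
  shows "promises k (insert e T) I \<or> (\<exists>f\<in>E - insert e T. promises k (insert e T) (insert f I))"
proof -
  obtain \<A> \<F> where sub: "\<A> \<subseteq> \<B>" "\<F> \<subseteq> \<B>" "\<A> \<inter> \<F> = {}"
    and A: "\<And>B. B \<in> \<A> \<Longrightarrow> wins B T I" and F: "\<And>B. B \<in> \<F> \<Longrightarrow> T \<inter> B = {}"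
    and k: "k \<le> card \<A> + card \<F> div 2"
    using assms(1) by (rule promisesE) (rule that)
  have fin: "finite \<A>" "finite \<F>" using sub finite_boards finite_subset by blast+
  consider (active) B where "B \<in> \<A>" "e \<in> B" | (fresh) B where "B \<in> \<F>" "e \<in> B"
    | (outside) "\<forall>B\<in>\<A> \<union> \<F>. e \<notin> B" by blast
  then show ?thesis
  proof cases
    case active
    have other: "e \<notin> C" if "C \<in> \<A> \<union> \<F>" "C \<noteq> B" for C
      using board_unique[of B C e] active that sub by blast
    have *: "promises k (insert e T) I'" if "wins B (insert e T) I'" "I \<subseteq> I'" for I'
    proof (rule promisesI[OF sub])
      fix C assume C: "C \<in> \<A>"
      show "wins C (insert e T) I'"
        by (cases "C = B") (use that C other A sub wins_elsewhere in blast)+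
    next
      fix C assume C: "C \<in> \<F>"
      then have "C \<noteq> B" using active sub by blast
      then show "insert e T \<inter> C = {}" using F[OF C] other C by blast
    qed (rule k)
    from A[OF active(1)] show ?thesis
    proof cases
      case (isolated v)
      then have "wins B (insert e T) I" by (intro wins.isolated)
      then show ?thesis using * by blast
    next
      case reply
      then obtain f where "f \<in> B - insert e T" "wins B (insert e T) (insert f I)"
        using active assms(2) by blast
      then show ?thesis using *[of "insert f I"] active(1) sub board by blast
    qed
  next
    case fresh
    have other: "e \<notin> C" if "C \<in> \<A> \<union> \<F>" "C \<noteq> B" for C
      using board_unique[of B C e] fresh that sub by blast
    show ?thesis
    proof (cases "\<exists>C\<in>\<F>. C \<noteq> B")
      case True
      then obtain C where C: "C \<in> \<F>" "C \<noteq> B" by blast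
      obtain f where f: "f \<in> C" "wins C {} {f}" using isolator_first C sub by blast
      have TC: "insert e T \<inter> C = {}" using F[OF C(1)] other C by blast
      have wC: "wins C (insert e T) (insert f I)"
        by (rule wins_mono[OF f(2)]) (use TC in auto)
      have "card \<F> = card (\<F> - {B, C}) + 2"
        using card_Diff_subset[of "{B, C}" \<F>] card_mono[of \<F> "{B, C}"] fresh(1) C fin by simp
      moreover have CA: "C \<notin> \<A>" using C sub by blast
      then have "card (insert C \<A>) = card \<A> + 1" using fin by simp
      ultimately have cnt: "k \<le> card (insert C \<A>) + card (\<F> - {B, C}) div 2" using k by simp
      have wD: "wins D (insert e T) (insert f I)" if "D \<in> insert C \<A>" for D
      proof (cases "D = C")
        case False
        then have D: "D \<in> \<A>" using that by blast
        then have "D \<noteq> B" using fresh sub by blast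
        then show ?thesis using D A other sub wins_elsewhere[of D T I e "insert f I"] by blast
      qed (use wC in simp)
      have TD: "insert e T \<inter> D = {}" if "D \<in> \<F> - {B, C}" for D
        using that F[of D] other[of D] by blast
      have "insert C \<A> \<subseteq> \<B>" "\<F> - {B, C} \<subseteq> \<B>" "insert C \<A> \<inter> (\<F> - {B, C}) = {}"
        using sub C(1) by auto
      then have "promises k (insert e T) (insert f I)"
        by (rule promisesI) (rule wD TD cnt; assumption?)+
      moreover have "C \<subseteq> E" using board C(1) sub(2) by (meson subsetD)
      then have "f \<in> E - insert e T" using f(1) TC by blast
      ultimately show ?thesis by blast
    next
      case False
      then have "\<F> = {B}" using fresh by blast
      then have "k \<le> card \<A>" using k by simp
      moreover have "wins D (insert e T) I" if "D \<in> \<A>" for D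
      proof -
        have "D \<noteq> B" using fresh sub that by blast
        then show ?thesis using that A other sub wins_elsewhere[of D T I e I] by blast
      qed
      ultimately have "promises k (insert e T) I"
        by (intro promisesI[of \<A> "{}"] sub) simp_all
      then show ?thesis by blast
    qed
  next
    case outside
    have "wins D (insert e T) I" if "D \<in> \<A>" for D
      using that A outside sub wins_elsewhere[of D T I e I] by blast
    moreover have "insert e T \<inter> D = {}" if "D \<in> \<F>" for D
      using that F[of D] outside by blast
    ultimately have "promises k (insert e T) I"
      by (intro promisesI[of \<A> \<F>] sub k)
    then show ?thesis by blast
  qed
qed

text \<open>
  At the end of the game every opened board contains a vertex all of whose edges belong to Isolator, and
  a board in which Toucher never played is untouched altogether.
\<close>

lemma promises_kept:
  assumes "promises k T I" "E \<subseteq> T \<union> I" "T \<inter> I = {}" "T \<subseteq> E"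
  shows "k \<le> card (untouched V T)"
proof -
  obtain \<A> \<F> where sub: "\<A> \<subseteq> \<B>" "\<F> \<subseteq> \<B>" "\<A> \<inter> \<F> = {}"
    and A: "\<And>B. B \<in> \<A> \<Longrightarrow> wins B T I" and F: "\<And>B. B \<in> \<F> \<Longrightarrow> T \<inter> B = {}"
    and k: "k \<le> card \<A> + card \<F> div 2"
    using assms(1) by (rule promisesE) (rule that)
  have fin: "finite \<A>" "finite \<F>" using sub finite_boards finite_subset by blast+
  have "\<exists>v. v \<in> \<Union>B \<and> v \<in> untouched V T" if "B \<in> \<A> \<union> \<F>" for B
  proof -
    have B: "B \<in> \<B>" "B \<subseteq> E" "B \<noteq> {}" "\<Union>B \<subseteq> V" "{} \<notin> B"
      using that sub board[of B] empty_notin_E by blast+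
    have "\<exists>v\<in>\<Union>B. \<forall>e\<in>B. v \<in> e \<longrightarrow> e \<notin> T"
    proof (cases "B \<in> \<A>")
      case True
      have "\<exists>v\<in>\<Union>B. \<forall>e\<in>B. v \<in> e \<longrightarrow> e \<in> I"
        by (rule wins_at_end[OF A[OF True]]) (use assms B in auto)
      then show ?thesis using assms(3) by blast
    next
      case False
      then have "T \<inter> B = {}" using that F by blast
      moreover obtain e where "e \<in> B" using B(3) by blast
      moreover then obtain v where "v \<in> e" using B(5) by (metis ex_in_conv)
      ultimately show ?thesis by blast
    qed
    then obtain v where v: "v \<in> \<Union>B" "\<forall>e\<in>B. v \<in> e \<longrightarrow> e \<notin> T" by blast
    have "v \<notin> e" if "e \<in> T" for e
      using closed[OF B(1) _ _ v(1), of e] v(2) that assms(4) by blast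
    then show ?thesis using v(1) B(4) unfolding untouched_def by blast
  qed
  then obtain w where w: "\<And>B. B \<in> \<A> \<union> \<F> \<Longrightarrow> w B \<in> \<Union>B \<and> w B \<in> untouched V T" by metis
  have "inj_on w (\<A> \<union> \<F>)"
  proof (rule inj_onI)
    fix B C assume "B \<in> \<A> \<union> \<F>" "C \<in> \<A> \<union> \<F>" "w B = w C"
    then show "B = C" using w[of B] w[of C] disjoint[of B C] sub
      by (metis IntI Un_iff empty_iff subsetD)
  qed
  then have "card (\<A> \<union> \<F>) \<le> card (untouched V T)"
    by (rule card_inj_on_le) (use w finite_V in \<open>auto simp: untouched_def\<close>)
  moreover have "card (\<A> \<union> \<F>) = card \<A> + card \<F>" using fin sub(3) by (rule card_Un_disjoint)
  ultimately show ?thesis using k by linarith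
qed

lemma promises_minimax:
  assumes "promises k T I" "T \<subseteq> E" "I \<subseteq> E" "T \<inter> I = {}"
  shows "k \<le> minimax V E Toucher T I"
  using assms
proof (induction "card (E - (T \<union> I))" arbitrary: T I rule: less_induct)
  case less
  show ?case
  proof (cases "E - (T \<union> I) = {}")
    case True
    then show ?thesis using less.prems promises_kept by (simp add: minimax_end)
  next
    case False
    show ?thesis
    proof (rule minimax_Toucher_ge[OF finite_E False])
      fix e assume e: "e \<in> E - (T \<union> I)"
      let ?T = "insert e T"
      have T: "?T \<subseteq> E" "?T \<inter> I = {}" using e less.prems by auto
      show "k \<le> minimax V E Isolator ?T I"
      proof (cases "E - (?T \<union> I) = {}")
        case True
        \<comment> \<open>Toucher has taken the last edge, so the answer can only repeat an edge of Isolator.\<close>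
        have "promises k ?T I"
        proof -
          from promises_step[OF less.prems(1) e] show ?thesis
          proof
            assume "\<exists>f\<in>E - ?T. promises k ?T (insert f I)"
            then obtain f where f: "f \<in> E - ?T" "promises k ?T (insert f I)" by blast
            then have "insert f I = I" using True by blast
            then show ?thesis using f by simp
          qed
        qed
        then have "k \<le> card (untouched V ?T)" by (rule promises_kept) (use True T in auto)
        then show ?thesis using True by (simp add: minimax_end)
      next
        case False
        have "\<exists>g\<in>E - (?T \<union> I). promises k ?T (insert g I)"
        proof (cases "promises k ?T I")
          case True
          \<comment> \<open>Isolator is obliged to move although nothing is called for: any edge will do.\<close>
          then show ?thesis using False promises_mono[of k ?T I] by blast
        next
          case not_pass: False
          then obtain f where f: "f \<in> E - ?T" "promises k ?T (insert f I)"
            using promises_step[OF less.prems(1) e] by blast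
          then have "f \<notin> I" using not_pass by (metis insert_absorb)
          then show ?thesis using f by blast
        qed
        then obtain g where g: "g \<in> E - (?T \<union> I)" "promises k ?T (insert g I)" by blast
        have "card (E - (?T \<union> insert g I)) < card (E - (T \<union> I))"
          by (rule psubset_card_mono) (use finite_E e in auto)
        then have "k \<le> minimax V E Toucher ?T (insert g I)"
          by (rule less.hyps) (use g T less.prems in auto)
        then show ?thesis using g(1) finite_E by (intro minimax_Isolator_ge)
      qed
    qed
  qed
qed

lemma half_the_boards_le_u: "card \<B> div 2 \<le> u V E"
proof -
  have "promises (card \<B> div 2) {} {}"
    by (rule promisesI[of "{}" \<B>]) simp_all
  then show ?thesis unfolding u_def by (intro promises_minimax) auto
qed

end

section \<open>Disjoint unions of regular graphs\<close>

lemma regular_graph_image: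
  assumes "regular_graph d V E" "inj \<phi>"
  shows "regular_graph d (\<phi> ` V) ((`) \<phi> ` E)"
proof -
  have "degree ((`) \<phi> ` E) (\<phi> v) = degree E v" for v
  proof -
    have "{e \<in> (`) \<phi> ` E. \<phi> v \<in> e} = (`) \<phi> ` {e \<in> E. v \<in> e}"
      using assms(2) by (auto simp: inj_eq)
    moreover have "inj_on ((`) \<phi>) X" for X
      using assms(2) by (simp add: inj_on_def inj_image_eq_iff)
    ultimately show ?thesis unfolding degree_def by (simp add: card_image)
  qed
  moreover have "card (\<phi> ` e) = card e" for e
    using assms(2) by (intro card_image) (auto simp: inj_on_def)
  moreover have "\<phi> ` e \<subseteq> \<phi> ` V" if "e \<in> E" for e
    using assms(1) that unfolding regular_graph_def simple_graph_def by (intro image_mono) simp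
  ultimately show ?thesis
    using assms(1) unfolding regular_graph_def simple_graph_def by simp
qed

lemma regular_graph_UN:
  assumes "finite J" and reg: "\<And>i. i \<in> J \<Longrightarrow> regular_graph d (V i) (E i)"
    and disj: "\<And>i j. i \<in> J \<Longrightarrow> j \<in> J \<Longrightarrow> i \<noteq> j \<Longrightarrow> V i \<inter> V j = {}"
  shows "regular_graph d (\<Union>i\<in>J. V i) (\<Union>i\<in>J. E i)"
proof -
  have sub: "e \<subseteq> V i \<and> card e = 2" if "i \<in> J" "e \<in> E i" for i e
    using reg[OF that(1)] that(2) unfolding regular_graph_def simple_graph_def by blast
  have "degree (\<Union>i\<in>J. E i) v = d" if i: "i \<in> J" "v \<in> V i" for i v
  proof -
    have "e \<in> E i" if "j \<in> J" "e \<in> E j" "v \<in> e" for j e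
      using disj[of i j] i that sub[of j e] by (cases "i = j") blast+
    then have "{e \<in> \<Union>i\<in>J. E i. v \<in> e} = {e \<in> E i. v \<in> e}" using i(1) by blast
    then show ?thesis using reg[OF i(1)] i(2) unfolding regular_graph_def degree_def by simp
  qed
  moreover have "finite (\<Union>i\<in>J. V i)"
    using assms(1) reg unfolding regular_graph_def simple_graph_def by blast
  moreover have "e \<subseteq> (\<Union>i\<in>J. V i) \<and> card e = 2" if "e \<in> (\<Union>i\<in>J. E i)" for e
    using that sub by blast
  ultimately show ?thesis unfolding regular_graph_def simple_graph_def by blast
qed

theorem theorem1p7:
  fixes n :: nat
  assumes "even n" and "n \<ge> 4"
  shows "\<exists>(V :: nat set) (E :: nat set set).
    regular_graph 3 V E \<and> card V = n \<and> int (u V E) \<ge> \<lfloor>real n / 24\<rfloor>"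
proof -
  define k where "k = n div 24"
  define m where "m = (n - 20 * k) div 2"
  have k: "24 * k \<le> n" unfolding k_def by simp
  have n: "n = 20 * k + 2 * m" and m: "m \<ge> 2"
  proof -
    have "even (n - 20 * k)" using assms(1) by simp
    then have "2 * m = n - 20 * k" unfolding m_def by simp
    then show "n = 20 * k + 2 * m" using k by linarith
    moreover have "n - 20 * k \<ge> 4" using k assms(2) by (cases "k = 0") linarith+
    ultimately show "m \<ge> 2" by linarith
  qed
  \<comment> \<open>Component \<open>i < 2 * k\<close> is a small ladder on the \<open>i\<close>-th block of ten numbers; the filler is component
      \<open>2 * k\<close>.\<close>
  define h where "h i = (if i < 2 * k then 5 else m)" for i
  define Vs where "Vs i = (+) (10 * i) ` {..<2 * h i}" for i
  define Es where "Es i = (`) ((+) (10 * i)) ` ladder (h i)" for i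
  define V where "V = (\<Union>i\<in>{..2 * k}. Vs i)"
  define E where "E = (\<Union>i\<in>{..2 * k}. Es i)"
  have reg: "regular_graph 3 (Vs i) (Es i)" for i
    unfolding Vs_def Es_def using m
    by (intro regular_graph_image regular_ladder) (auto simp: h_def)
  have disj: "Vs i \<inter> Vs j = {}" if "i \<le> 2 * k" "j \<le> 2 * k" "i \<noteq> j" for i j
    using that
  proof (induction i j rule: linorder_wlog)
    case (le i j)
    then have "h i = 5" by (simp add: h_def)
    then show ?case using le unfolding Vs_def by auto
  next
    case (sym i j)
    then show ?case by (simp add: Int_commute)
  qed
  have regVE: "regular_graph 3 V E"
    unfolding V_def E_def by (rule regular_graph_UN) (use reg disj in auto)
  have "V = {..<n}"
  proof
    show "V \<subseteq> {..<n}" unfolding V_def Vs_def h_def n by (auto split: if_splits)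
    show "{..<n} \<subseteq> V"
    proof
      fix x assume x: "x \<in> {..<n}"
      show "x \<in> V"
      proof (cases "x < 20 * k")
        case True
        then have i: "x div 10 < 2 * k" by linarith
        have "x = 10 * (x div 10) + x mod 10" by simp
        then have "x \<in> Vs (x div 10)" unfolding Vs_def h_def using i
          by (intro image_eqI[of _ _ "x mod 10"]) auto
        then show ?thesis unfolding V_def using i by (intro UN_I[of "x div 10"]) auto
      next
        case False
        then have "x = 10 * (2 * k) + (x - 20 * k)" "x - 20 * k < 2 * m" using x n by auto
        then have "x \<in> Vs (2 * k)" unfolding Vs_def h_def
          by (intro image_eqI[of _ _ "x - 20 * k"]) auto
        then show ?thesis unfolding V_def by blast
      qed
    qed
  qed
  then have card_V: "card V = n" by simp
  have edge: "e \<subseteq> Vs i \<and> e \<noteq> {}" if "e \<in> Es i" for e i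
    using reg[of i] that unfolding regular_graph_def simple_graph_def by fastforce
  have nonempty: "Es i \<noteq> {}" for i
    unfolding Es_def ladder_def by simp
  have same: "i = j" if "e \<in> Es i" "f \<in> Es j" "v \<in> e" "v \<in> f" "i \<le> 2 * k" "j \<le> 2 * k" for e f v i j
    using edge[OF that(1)] edge[OF that(2)] disj[of i j] that by blast
  interpret boards V E "Es ` {..<2 * k}"
  proof
    show "finite V" using \<open>V = {..<n}\<close> by simp
    have "E \<subseteq> Pow V" using regVE unfolding regular_graph_def simple_graph_def by blast
    then show "finite E" using \<open>finite V\<close> finite_subset by blast
    show "{} \<notin> E" unfolding E_def using edge by blast
  next
    fix B assume "B \<in> Es ` {..<2 * k}"
    then obtain i where i: "i < 2 * k" "B = Es i" by blast
    have "i \<in> {..2 * k}" using i by simp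
    then have "B \<subseteq> E" "Vs i \<subseteq> V" unfolding i(2) E_def V_def by blast+
    moreover have "\<Union>B \<subseteq> Vs i" unfolding i(2) using edge by blast
    ultimately show "B \<subseteq> E \<and> B \<noteq> {} \<and> \<Union>B \<subseteq> V" using nonempty i(2) by blast
    show "\<exists>f\<in>B. wins B {} {f}"
    proof -
      obtain f where f: "f \<in> ladder 5" "wins (ladder 5) {} {f}"
        using ladder5_isolator_first by blast
      have "wins B {} {(+) (10 * i) ` f}"
        using wins_image[OF f(2), of "(+) (10 * i)"] i unfolding Es_def h_def by simp
      then show ?thesis using f(1) i unfolding Es_def h_def by auto
    qed
    fix e v assume "e \<in> E" "v \<in> e" "v \<in> \<Union>B"
    then obtain j where "j \<le> 2 * k" "e \<in> Es j" unfolding E_def by blast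
    then show "e \<in> B" using same[of e j _ i v] \<open>v \<in> e\<close> \<open>v \<in> \<Union>B\<close> i by auto
  next
    fix B C assume "B \<in> Es ` {..<2 * k}" "C \<in> Es ` {..<2 * k}" "B \<noteq> C"
    then obtain i j where BC: "B = Es i" "C = Es j" and "i < 2 * k" "j < 2 * k" by blast
    then have ij: "i \<le> 2 * k" "j \<le> 2 * k" "i \<noteq> j" using \<open>B \<noteq> C\<close> by auto
    have "\<Union>B \<subseteq> Vs i" "\<Union>C \<subseteq> Vs j" unfolding BC using edge by blast+
    then show "\<Union>B \<inter> \<Union>C = {}" using disj[OF ij] by blast
  qed
  have "inj_on Es {..<2 * k}"
  proof (rule inj_onI)
    fix i j assume ij: "i \<in> {..<2 * k}" "j \<in> {..<2 * k}" "Es i = Es j"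
    obtain e where "e \<in> Es i" using nonempty by blast
    moreover then obtain v where "v \<in> e" using edge by blast
    ultimately show "i = j" using same[of e i e j v] ij by auto
  qed
  then have "k \<le> u V E" using half_the_boards_le_u by (simp add: card_image)
  moreover have "\<lfloor>real n / 24\<rfloor> = int k"
    unfolding k_def using floor_divide_of_nat_eq[of n 24] by simp
  ultimately show ?thesis using regVE card_V by (intro exI[of _ V] exI[of _ E]) simp
qed

end
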